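(* Let $a>0$ and let $k\le m$ be nonnegative integers. There exists a constant $C>0$, depending only on $m$ and $a$, such that for every function $p\in h^{m}(w^{-1};\mathbf{Z}_+)$ and every integer $N\ge 1$, $$\big\| \tilde{\pi}_{N-1}p-p\big\|_{h^{k}(w^{-1};\mathbf{Z}_+)}\;\le\; C\,(a/N)^{m/2}\,\big(\max\{1,N/a\}\big)^{k/2}\,\|p\|_{h^{m}(w^{-1};\mathbf{Z}_+)} .$$ Moreover, if $a\ge 1$ is assumed, then $C$ can be taken to depend only on $m$.
   Context: $\mathbf{Z}_+=\{0,1,2,\dots\}$; all functions are real-valued on $\mathbf{Z}_+$. Fix a parameter $a>0$ and let $w(x)=\frac{a^x}{x!}e^{-a}$ be the Poisson weight. Write $x^{\underline{k}}=\prod_{i=0}^{k-1}(x-i)$ for the falling factorial power (with $x^{\underline{0}}=1$). Inner products: $(p,q)=\sum_{x\ge 0}p(x)q(x)$, $(p,q)_w=(p,qw)$, $(p,q)_{w^{-1}}=(p,qw^{-1})$. For a weight $v\in\{w,w^{-1}\}$, $l^2(v;\mathbf{Z}_+)$ is the space of functions $q$ with $\|q\|_{l^2(v;\mathbf{Z}_+)}^2=(q,qv)<\infty$. Weighted Sobolev sequence spaces: for an integer $m\ge 0$, $h^m(v;\mathbf{Z}_+)$ is the space of $q:\mathbf{Z}_+\to\mathbf{R}$ with $\sqrt{x^{\underline{k}}}\,q(x)\in l^2(v;\mathbf{Z}_+)$ for $0\le k\le m$, with norm $$\|q\|_{h^m(v;\mathbf{Z}_+)}^2=\sum_{k=0}^m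 a^{-k}\sum_{x\ge 0}x^{\underline{k}}\,q(x)^2\,v(x).$$ Poisson-Charlier polynomials: $C_0^a(x)=1$, $C_1^a(x)=\frac{a-x}{\sqrt a}$, and $C_{n+1}^a(x)=\frac{n+a-x}{\sqrt{a(n+1)}}C_n^a(x)-\sqrt{\frac{n}{n+1}}\,C_{n-1}^a(x)$ for $n\ge 1$. They are orthonormal with respect to $(\cdot,\cdot)_w$. The Poisson-Charlier functions are $\tilde C_n^a(x)=C_n^a(x)w(x)$; they are orthonormal with respect to $(\cdot,\cdot)_{w^{-1}}$. For an integer $N\ge 0$, $\tilde\pi_N$ denotes the $(\cdot,\cdot)_{w^{-1}}$-orthogonal projection of $l^2(w^{-1};\mathbf{Z}_+)$ onto $\tilde P_N=\{q\cdot w:\ q \text{ a polynomial of degree}\le N\}$, i.e. $\tilde\pi_N p=\sum_{n=0}^N (p,\tilde C_n^a)_{w^{-1}}\tilde C_n^a$. *)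

theory Defs
  imports "HOL-Analysis.Analysis"
begin

definition poisson_weight :: "real \<Rightarrow> nat \<Rightarrow> real" where
  "poisson_weight a x = a ^ x / fact x * exp (- a)"

definition poisson_weight_inv :: "real \<Rightarrow> nat \<Rightarrow> real" where
  "poisson_weight_inv a x = inverse (poisson_weight a x)"

text \<open>Falling factorial power of a point of the grid; the factors are taken in the reals, so that
  there is no truncated subtraction (the product vanishes for \<open>x < k\<close> either way).\<close>

definition falling_power :: "nat \<Rightarrow> nat \<Rightarrow> real" where
  "falling_power x k = (\<Prod>i<k. real x - real i)"

definition weighted_inner :: "(nat \<Rightarrow> real) \<Rightarrow> (nat \<Rightarrow> real) \<Rightarrow> (nat \<Rightarrow> real) \<Rightarrow> real" where
  "weighted_inner v p q = (\<Sum>x. p x * q x * v x)"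

definition l2_space :: "(nat \<Rightarrow> real) \<Rightarrow> (nat \<Rightarrow> real) set" where
  "l2_space v = {q. summable (\<lambda>x. (q x)\<^sup>2 * v x)}"

definition h_space :: "nat \<Rightarrow> (nat \<Rightarrow> real) \<Rightarrow> (nat \<Rightarrow> real) set" where
  "h_space m v = {q. \<forall>k\<le>m. (\<lambda>x. sqrt (falling_power x k) * q x) \<in> l2_space v}"

text \<open>The norm is meaningful only on \<open>h_space m v\<close>: off it, some of the infinite sums below need
  not converge and \<open>suminf\<close> carries no information.\<close>

definition h_norm :: "real \<Rightarrow> nat \<Rightarrow> (nat \<Rightarrow> real) \<Rightarrow> (nat \<Rightarrow> real) \<Rightarrow> real" where
  "h_norm a m v q =
     sqrt (\<Sum>k\<le>m. inverse (a ^ k) * (\<Sum>x. falling_power x k * (q x)\<^sup>2 * v x))"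

text \<open>Orthonormal Poisson-Charlier polynomials on the grid. The last equation is the three-term
  recurrence for \<open>C\<^bsub>n+1\<^esub>\<close> with \<open>n + 1\<close> in place of \<open>n\<close>.\<close>

fun charlier :: "real \<Rightarrow> nat \<Rightarrow> nat \<Rightarrow> real" where
  "charlier a 0 x = 1"
| "charlier a (Suc 0) x = (a - real x) / sqrt a"
| "charlier a (Suc (Suc n)) x =
     (real (n + 1) + a - real x) / sqrt (a * real (n + 2)) * charlier a (Suc n) x
     - sqrt (real (n + 1) / real (n + 2)) * charlier a n x"

definition charlier_fun :: "real \<Rightarrow> nat \<Rightarrow> nat \<Rightarrow> real" where
  "charlier_fun a n x = charlier a n x * poisson_weight a x"

text \<open>Orthogonal projection of \<open>l2_space (poisson_weight_inv a)\<close> onto the products of the Poisson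
  weight with polynomials of degree at most \<open>N\<close>, given by its expansion in the orthonormal basis
  \<open>charlier_fun a 0, \<dots>, charlier_fun a N\<close> of that subspace.\<close>

definition charlier_proj :: "real \<Rightarrow> nat \<Rightarrow> (nat \<Rightarrow> real) \<Rightarrow> nat \<Rightarrow> real" where
  "charlier_proj a N p x =
     (\<Sum>n\<le>N. weighted_inner (poisson_weight_inv a) p (charlier_fun a n) * charlier_fun a n x)"

end

theory Submission
  imports Defs
begin

text \<open>Write \<open>p = q w\<close> with \<open>w\<close> the Poisson weight. Because \<open>x\<close> falling \<open>k\<close>, times \<open>w x\<close>, is
  \<open>a\<^sup>k\<close> times \<open>w (x - k)\<close>, the squared norm of \<open>p\<close> in \<open>h\<^sup>m\<close> equals the sum over \<open>j \<le> m\<close> of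
  the squared \<open>w\<close>-weighted norms of the shifts \<open>q (\<cdot> + j)\<close> (\<open>h_norm_eq_shifts\<close>). Shifts are
  combinations of iterated forward differences and conversely, pointwise and with constants
  \<open>4\<^sup>j\<close>; so that norm may be replaced by the sum of the squared norms of the differences of \<open>q\<close>.

  The differences act as weighted shifts on the Charlier basis: the operator adjoint to the forward
  difference sends \<open>C\<^sub>n\<close> to \<open>- sqrt ((n+1)/a)\<close> times \<open>C\<close> of index \<open>n + 1\<close>. Hence, by Parseval,
  the squared norm of the \<open>i\<close>-th difference of \<open>q\<close> is the sum over \<open>n\<close> of \<open>n\<close> falling \<open>i\<close>, over
  \<open>a\<^sup>i\<close>, times the square of the \<open>n\<close>-th coefficient of \<open>q\<close> (\<open>iterated_diff_parseval\<close>). The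
  projection removes the terms with \<open>n < N\<close>, and for \<open>n \<ge> N\<close> the spectral weight of order
  \<open>i \<le> k\<close> is at most a multiple of \<open>(a/N)\<^sup>m max(1, N/a)\<^sup>k\<close> times the sum of the weights up to
  order \<open>m\<close> (\<open>spectral_tail_bound\<close>). That comparison is the whole estimate. The constant
  depends on \<open>a\<close> only when \<open>a < 1\<close>, through the indices \<open>N \<le> n < m\<close>, at which the weight of
  order \<open>m\<close> vanishes.

  Parseval's identity, that is, the completeness of the Charlier polynomials, comes from their
  self-duality: up to factors depending on \<open>n\<close> alone, \<open>C\<^sub>n x\<close> is a kernel symmetric in \<open>n\<close> and
  \<open>x\<close>. The orthogonality of the polynomials is thus also an orthogonality in the index \<open>n\<close>, which
  is Parseval's identity for point masses; density of the finitely supported functions does the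
  rest.\<close>

section \<open>Square-summable functions for a nonnegative weight\<close>

lemma l2_space_scale:
  assumes "f \<in> l2_space v"
  shows "(\<lambda>x. c * f x) \<in> l2_space v"
proof -
  have "summable (\<lambda>x. c\<^sup>2 * ((f x)\<^sup>2 * v x))"
    using assms by (intro summable_mult) (simp add: l2_space_def)
  then show ?thesis
    by (simp add: l2_space_def power_mult_distrib mult.assoc)
qed

text \<open>By \<open>2 |f g| \<le> f\<^sup>2 + g\<^sup>2\<close>.\<close>

lemma l2_space_product_summable:
  assumes "\<And>x. v x \<ge> 0" "f \<in> l2_space v" "g \<in> l2_space v"
  shows "summable (\<lambda>x. f x * g x * v x)"
proof (rule summable_comparison_test')
  show "summable (\<lambda>x. (f x)\<^sup>2 * v x + (g x)\<^sup>2 * v x)"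
    using assms by (intro summable_add) (auto simp: l2_space_def)
  show "norm (f x * g x * v x) \<le> (f x)\<^sup>2 * v x + (g x)\<^sup>2 * v x" for x
  proof -
    have "0 \<le> (\<bar>f x\<bar> - \<bar>g x\<bar>)\<^sup>2"
      by simp
    then have "2 * (\<bar>f x\<bar> * \<bar>g x\<bar>) \<le> (f x)\<^sup>2 + (g x)\<^sup>2"
      by (simp add: power2_diff)
    moreover have "0 \<le> \<bar>f x\<bar> * \<bar>g x\<bar>"
      by simp
    ultimately have "\<bar>f x\<bar> * \<bar>g x\<bar> \<le> (f x)\<^sup>2 + (g x)\<^sup>2"
      by linarith
    then have "\<bar>f x\<bar> * \<bar>g x\<bar> * v x \<le> ((f x)\<^sup>2 + (g x)\<^sup>2) * v x"
      using assms(1) by (rule mult_right_mono)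
    then show ?thesis
      using assms(1)[of x] by (simp add: abs_mult distrib_right)
  qed
qed

lemma l2_space_add:
  assumes "\<And>x. v x \<ge> 0" "f \<in> l2_space v" "g \<in> l2_space v"
  shows "(\<lambda>x. f x + g x) \<in> l2_space v"
proof -
  have "summable (\<lambda>x. (f x)\<^sup>2 * v x + (g x)\<^sup>2 * v x + 2 * (f x * g x * v x))"
    using assms l2_space_product_summable[OF assms]
    by (intro summable_add summable_mult) (auto simp: l2_space_def)
  then show ?thesis
    by (simp add: l2_space_def power2_sum algebra_simps)
qed

lemma l2_space_diff:
  assumes "\<And>x. v x \<ge> 0" "f \<in> l2_space v" "g \<in> l2_space v"
  shows "(\<lambda>x. f x - g x) \<in> l2_space v"
  using l2_space_add[OF assms(1,2) l2_space_scale[OF assms(3), of "-1"]] by simp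

lemma l2_space_sum:
  assumes "\<And>x. v x \<ge> 0" "finite I" "\<And>i. i \<in> I \<Longrightarrow> f i \<in> l2_space v"
  shows "(\<lambda>x. \<Sum>i\<in>I. f i x) \<in> l2_space v"
  using assms(2,3)
proof (induction I rule: finite_induct)
  case empty
  then show ?case by (simp add: l2_space_def)
next
  case (insert i I)
  then show ?case using l2_space_add[OF assms(1)] by simp
qed

lemma weighted_inner_commute: "weighted_inner v f g = weighted_inner v g f"
  by (simp add: weighted_inner_def mult.commute)

lemma weighted_inner_diff_left:
  assumes "\<And>x. v x \<ge> 0" "f \<in> l2_space v" "g \<in> l2_space v" "h \<in> l2_space v"
  shows "weighted_inner v (\<lambda>x. f x - g x) h = weighted_inner v f h - weighted_inner v g h"
  using l2_space_product_summable[OF assms(1,2,4)] l2_space_product_summable[OF assms(1,3,4)]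
  by (simp add: weighted_inner_def suminf_diff algebra_simps)

lemma weighted_inner_scale_left:
  assumes "\<And>x. v x \<ge> 0" "f \<in> l2_space v" "h \<in> l2_space v"
  shows "weighted_inner v (\<lambda>x. c * f x) h = c * weighted_inner v f h"
  using suminf_mult[OF l2_space_product_summable[OF assms], of c]
  by (simp add: weighted_inner_def algebra_simps)

lemma weighted_inner_sum_left:
  assumes "\<And>x. v x \<ge> 0" "\<And>i. i \<in> I \<Longrightarrow> f i \<in> l2_space v" "h \<in> l2_space v"
  shows "weighted_inner v (\<lambda>x. \<Sum>i\<in>I. c i * f i x) h = (\<Sum>i\<in>I. c i * weighted_inner v (f i) h)"
proof -
  have sm: "summable (\<lambda>x. c i * (f i x * h x * v x))" if "i \<in> I" for i
    using that assms by (intro summable_mult l2_space_product_summable)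
  have "weighted_inner v (\<lambda>x. \<Sum>i\<in>I. c i * f i x) h
      = (\<Sum>x. \<Sum>i\<in>I. c i * (f i x * h x * v x))"
    by (simp add: weighted_inner_def sum_distrib_right mult.assoc)
  also have "\<dots> = (\<Sum>i\<in>I. \<Sum>x. c i * (f i x * h x * v x))"
    using sm by (rule suminf_sum)
  also have "\<dots> = (\<Sum>i\<in>I. c i * weighted_inner v (f i) h)"
    unfolding weighted_inner_def
    by (intro sum.cong refl suminf_mult l2_space_product_summable assms)
  finally show ?thesis .
qed

lemma weighted_inner_self_nonneg:
  assumes "\<And>x. v x \<ge> 0" "f \<in> l2_space v"
  shows "weighted_inner v f f \<ge> 0"
  using assms l2_space_product_summable[OF assms(1,2,2)]
  unfolding weighted_inner_def by (intro suminf_nonneg) auto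

lemma orthonormal_remainder_inner:
  fixes N :: nat
  assumes v: "\<And>x. v x \<ge> 0" and \<phi>: "\<And>n. \<phi> n \<in> l2_space v"
    and orth: "\<And>i j. weighted_inner v (\<phi> i) (\<phi> j) = (if i = j then 1 else 0)"
    and q: "q \<in> l2_space v"
  shows "weighted_inner v (\<lambda>x. q x - (\<Sum>i<N. weighted_inner v q (\<phi> i) * \<phi> i x)) (\<phi> n)
       = (if n < N then 0 else weighted_inner v q (\<phi> n))"
proof -
  let ?s = "\<lambda>x. \<Sum>i<N. weighted_inner v q (\<phi> i) * \<phi> i x"
  have s: "?s \<in> l2_space v"
    using v \<phi> by (intro l2_space_sum l2_space_scale) auto
  have "weighted_inner v ?s (\<phi> n) = (\<Sum>i<N. weighted_inner v q (\<phi> i) * (if i = n then 1 else 0))"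
    using v \<phi> by (subst weighted_inner_sum_left) (auto simp: orth)
  also have "\<dots> = (if n < N then weighted_inner v q (\<phi> n) else 0)"
    by (simp add: if_distrib cong: if_cong)
  finally show ?thesis
    using weighted_inner_diff_left[OF v q s \<phi>[of n]] by simp
qed

text \<open>The squared norm of the remainder of \<open>q\<close> after its first \<open>N\<close> terms is nonnegative, and it
  equals that of \<open>q\<close> minus the squares of the first \<open>N\<close> coefficients.\<close>

lemma bessel:
  assumes v: "\<And>x. v x \<ge> 0" and \<phi>: "\<And>n. \<phi> n \<in> l2_space v"
    and orth: "\<And>i j. weighted_inner v (\<phi> i) (\<phi> j) = (if i = j then 1 else 0)"
    and q: "q \<in> l2_space v"
  shows "summable (\<lambda>n. (weighted_inner v q (\<phi> n))\<^sup>2)"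
    and "(\<Sum>n. (weighted_inner v q (\<phi> n))\<^sup>2) \<le> weighted_inner v q q"
proof -
  have bound: "(\<Sum>n<N. (weighted_inner v q (\<phi> n))\<^sup>2) \<le> weighted_inner v q q" for N
  proof -
    let ?s = "\<lambda>x. \<Sum>i<N. weighted_inner v q (\<phi> i) * \<phi> i x"
    let ?r = "\<lambda>x. q x - ?s x"
    have s: "?s \<in> l2_space v"
      using v \<phi> by (intro l2_space_sum l2_space_scale) auto
    have r: "?r \<in> l2_space v"
      by (rule l2_space_diff[OF v q s])
    have "weighted_inner v ?s ?r = (\<Sum>i<N. weighted_inner v q (\<phi> i) * weighted_inner v (\<phi> i) ?r)"
      using v \<phi> r by (intro weighted_inner_sum_left)
    also have "\<dots> = 0"
      by (intro sum.neutral)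
        (simp add: weighted_inner_commute[of v "\<phi> _"] orthonormal_remainder_inner[OF v \<phi> orth q])
    finally have "weighted_inner v ?r ?r = weighted_inner v ?r q"
      using weighted_inner_diff_left[OF v q s r] by (simp add: weighted_inner_commute)
    also have "\<dots> = weighted_inner v q q - weighted_inner v ?s q"
      by (rule weighted_inner_diff_left[OF v q s q])
    also have "weighted_inner v ?s q = (\<Sum>i<N. weighted_inner v q (\<phi> i) * weighted_inner v (\<phi> i) q)"
      using v \<phi> q by (intro weighted_inner_sum_left)
    finally show ?thesis
      using weighted_inner_self_nonneg[OF v r]
      by (simp add: weighted_inner_commute[of v "\<phi> _"] power2_eq_square)
  qed
  show sm: "summable (\<lambda>n. (weighted_inner v q (\<phi> n))\<^sup>2)"
    by (rule summableI_nonneg_bounded[OF _ bound]) simp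
  show "(\<Sum>n. (weighted_inner v q (\<phi> n))\<^sup>2) \<le> weighted_inner v q q"
    by (rule suminf_le_const[OF sm bound])
qed

section \<open>The symmetric kernel of the Poisson-Charlier polynomials\<close>

text \<open>The hypergeometric polynomial \<open>\<^sub>2F\<^sub>0(-n, -x; ; -1/a)\<close>, the classical Charlier polynomial
  with value \<open>1\<close> at \<open>x = 0\<close>. The terms with \<open>j > min n x\<close> vanish, which makes it symmetric.\<close>

definition charlier_kernel :: "real \<Rightarrow> nat \<Rightarrow> nat \<Rightarrow> real" where
  "charlier_kernel a n x =
     (\<Sum>j\<le>n. (-1) ^ j * real (n choose j) * real (x choose j) * fact j / a ^ j)"

lemma charlier_kernel_commute: "charlier_kernel a n x = charlier_kernel a x n"
proof -
  have "charlier_kernel a n x =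
      (\<Sum>j\<le>max n x. (-1) ^ j * real (n choose j) * real (x choose j) * fact j / a ^ j)" for n x
    unfolding charlier_kernel_def by (rule sum.mono_neutral_left) auto
  from this[of n x] this[of x n] show ?thesis
    by (simp add: max.commute mult.assoc mult.left_commute)
qed

lemma charlier_kernel_0_left [simp]: "charlier_kernel a 0 x = 1"
  by (simp add: charlier_kernel_def)

lemma charlier_kernel_0_right [simp]: "charlier_kernel a n 0 = 1"
  by (subst charlier_kernel_commute) simp

text \<open>Pascal's rule lowers the index of \<open>x choose Suc j\<close>; the factor \<open>Suc n\<close> then comes from
  absorption in the binomial coefficient of \<open>Suc n\<close>.\<close>

lemma charlier_kernel_diff_right:
  assumes "a > 0"
  shows "charlier_kernel a (Suc n) (Suc x) - charlier_kernel a (Suc n) x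
       = - (real (Suc n) / a) * charlier_kernel a n x"
proof -
  have absorb: "real (Suc n choose Suc j) * fact (Suc j) = real (Suc n) * real (n choose j) * fact j"
    for j
  proof -
    have "real (Suc j) * real (Suc n choose Suc j) = real (Suc n) * real (n choose j)"
      by (metis Suc_times_binomial of_nat_mult)
    moreover have "(fact (Suc j) :: real) = real (Suc j) * fact j"
      by simp
    ultimately show ?thesis
      by (metis mult.assoc mult.commute)
  qed
  have "charlier_kernel a (Suc n) (Suc x) - charlier_kernel a (Suc n) x
      = (\<Sum>j\<le>n. - ((-1) ^ j * (real (Suc n choose Suc j) * fact (Suc j)) * real (x choose j)
          / a ^ Suc j))"
  proof -
    have "charlier_kernel a (Suc n) y = 1 + (\<Sum>j\<le>n. - ((-1) ^ j * (real (Suc n choose Suc j)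
        * fact (Suc j)) * real (y choose Suc j) / a ^ Suc j))" for y
      unfolding charlier_kernel_def sum.atMost_Suc_shift by (simp add: mult_ac del: fact_Suc binomial_Suc_Suc)
    moreover have "real (Suc x choose Suc j) = real (x choose j) + real (x choose Suc j)" for j
      by simp
    ultimately show ?thesis
      by (simp only: add_diff_cancel_left sum_subtractf[symmetric])
        (simp only: distrib_left add_divide_distrib minus_add_distrib add_diff_cancel_right')
  qed
  also have "\<dots> = - (real (Suc n) / a) * charlier_kernel a n x"
    unfolding charlier_kernel_def absorb sum_distrib_left
    by (intro sum.cong refl) (use assms in \<open>simp add: field_simps\<close>)
  finally show ?thesis .
qed

lemma charlier_kernel_diff_left:
  assumes "a > 0"
  shows "charlier_kernel a (Suc n) (Suc x) - charlier_kernel a n (Suc x)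
       = - (real (Suc x) / a) * charlier_kernel a n x"
  using charlier_kernel_diff_right[OF assms, of x n] by (simp add: charlier_kernel_commute)

text \<open>Both difference equations relate neighbouring entries of the kernel; eliminating the values at
  \<open>x - 1\<close> between them leaves a recurrence in \<open>n\<close>.\<close>

lemma charlier_kernel_three_term:
  assumes "a > 0"
  shows "a * charlier_kernel a (Suc (Suc n)) x
       = (real (Suc n) + a - real x) * charlier_kernel a (Suc n) x - real (Suc n) * charlier_kernel a n x"
proof (cases x)
  case 0
  then show ?thesis by simp
next
  case (Suc y)
  let ?d = "charlier_kernel a"
  have 1: "a * ?d (Suc (Suc n)) x = a * ?d (Suc n) x - real x * ?d (Suc n) y"
    using charlier_kernel_diff_left[OF assms, of "Suc n" y] assms Suc by (simp add: field_simps)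
  have 2: "a * ?d (Suc n) x = a * ?d n x - real x * ?d n y"
    using charlier_kernel_diff_left[OF assms, of n y] assms Suc by (simp add: field_simps)
  have 3: "?d (Suc n) y = ?d (Suc n) x + real (Suc n) / a * ?d n y"
    using charlier_kernel_diff_right[OF assms, of n y] assms Suc by simp
  have "real x * ?d (Suc n) y = real x * ?d (Suc n) x + real (Suc n) / a * (real x * ?d n y)"
    unfolding 3 by (simp add: algebra_simps)
  also have "real x * ?d n y = a * (?d n x - ?d (Suc n) x)"
    using 2 by (simp add: algebra_simps)
  finally have "real x * ?d (Suc n) y = real x * ?d (Suc n) x + real (Suc n) * (?d n x - ?d (Suc n) x)"
    using assms by simp
  then show ?thesis
    unfolding 1 by (simp add: algebra_simps)
qed

lemma charlier_eq_kernel: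
  assumes a: "a > 0"
  shows "charlier a n x = sqrt (a ^ n / fact n) * charlier_kernel a n x"
  using assms
proof (induction a n x rule: charlier.induct)
  case (2 a x)
  then have "sqrt a * sqrt a = a" by simp
  with 2 show ?case
    by (simp add: charlier_kernel_def field_simps)
next
  case (3 a n x)
  define s where "s = (\<lambda>n. sqrt (a ^ n / fact n))"
  have s_Suc: "s (Suc n) = s n * sqrt a / sqrt (real (Suc n))" for n
    by (simp add: s_def real_sqrt_mult real_sqrt_divide mult.commute del: of_nat_Suc)
  have sa: "sqrt a * sqrt a = a" "sqrt a > 0"
    using 3 by auto
  have n1: "sqrt (real (Suc n)) * sqrt (real (Suc n)) = real (Suc n)" "sqrt (real (Suc n)) > 0"
    by auto
  have e: "sqrt (a * real (n + 2)) = sqrt a * sqrt (real (Suc (Suc n)))"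
    "sqrt (real (n + 1) / real (n + 2)) = sqrt (real (Suc n)) / sqrt (real (Suc (Suc n)))"
    by (simp_all add: real_sqrt_mult real_sqrt_divide)
  have s1: "s (Suc n) / sqrt (a * real (n + 2)) = s (Suc (Suc n)) / a"
    unfolding s_Suc[of "Suc n"] e using sa 3 by (simp add: field_simps)
  have s2: "sqrt (real (n + 1) / real (n + 2)) * s n = s (Suc (Suc n)) * real (Suc n) / a"
    unfolding s_Suc[of "Suc n"] s_Suc[of n] e using sa n1 3
    by (simp add: field_simps del: of_nat_Suc)
  have "charlier a (Suc (Suc n)) x
      = (real (Suc n) + a - real x) * (s (Suc n) / sqrt (a * real (n + 2))) * charlier_kernel a (Suc n) x
        - (sqrt (real (n + 1) / real (n + 2)) * s n) * charlier_kernel a n x"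
    using 3 by (simp add: s_def)
  also have "\<dots> = s (Suc (Suc n)) / a * ((real (Suc n) + a - real x) * charlier_kernel a (Suc n) x
        - real (Suc n) * charlier_kernel a n x)"
    unfolding s1 s2 by (simp add: right_diff_distrib diff_divide_distrib mult.assoc mult.left_commute
        del: of_nat_Suc)
  also have "\<dots> = s (Suc (Suc n)) * charlier_kernel a (Suc (Suc n)) x"
    using 3(3) unfolding charlier_kernel_three_term[OF 3(3), symmetric] by simp
  finally show ?case by (simp only: s_def)
qed simp

section \<open>Orthonormality and completeness of the Poisson-Charlier polynomials\<close>

definition forward_diff :: "(nat \<Rightarrow> real) \<Rightarrow> nat \<Rightarrow> real" where
  "forward_diff f x = f (Suc x) - f x"

lemma poisson_weight_pos: "a > 0 \<Longrightarrow> poisson_weight a x > 0"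
  by (simp add: poisson_weight_def)

lemma poisson_weight_nonneg: "a > 0 \<Longrightarrow> poisson_weight a x \<ge> 0"
  using poisson_weight_pos[of a x] by simp

lemma poisson_weight_Suc: "real (Suc x) * poisson_weight a (Suc x) = a * poisson_weight a x"
  by (simp add: poisson_weight_def divide_simps del: of_nat_Suc)

lemma poisson_weight_sums: "poisson_weight a sums 1"
proof -
  have "(\<lambda>x. a ^ x /\<^sub>R fact x * exp (- a)) sums (exp a * exp (- a))"
    by (intro sums_mult2 exp_converges)
  then show ?thesis
    by (simp add: poisson_weight_def[abs_def] divide_inverse mult.commute flip: exp_add)
qed

text \<open>The series of \<open>4\<^sup>x w x\<close> is exponential. A class of functions closed under shifts is
  wanted, because shifts of Charlier polynomials have to be square-summable too; the base \<open>2\<close>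
  suits the bound \<open>2\<^sup>x\<close> on binomial coefficients.\<close>

lemma l2_space_poisson_exponential_bound:
  assumes "a > 0" "\<And>x. \<bar>f x\<bar> \<le> M * 2 ^ x"
  shows "f \<in> l2_space (poisson_weight a)"
proof -
  have "summable (\<lambda>x. M\<^sup>2 * exp (- a) * ((4 * a) ^ x /\<^sub>R fact x))"
    by (intro summable_mult summable_exp_generic)
  moreover have "norm ((f x)\<^sup>2 * poisson_weight a x) \<le> M\<^sup>2 * exp (- a) * ((4 * a) ^ x /\<^sub>R fact x)" for x
  proof -
    have "(4::real) ^ x = (2 ^ x)\<^sup>2"
      by (simp add: power2_eq_square flip: power_mult_distrib)
    moreover have "(f x)\<^sup>2 \<le> (M * 2 ^ x)\<^sup>2"
      using power_mono[OF assms(2)[of x], of 2] by simp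
    ultimately have "(f x)\<^sup>2 \<le> M\<^sup>2 * 4 ^ x"
      by (simp add: power_mult_distrib)
    then have "(f x)\<^sup>2 * poisson_weight a x \<le> M\<^sup>2 * 4 ^ x * poisson_weight a x"
      using poisson_weight_nonneg[OF assms(1)] by (rule mult_right_mono)
    also have "\<dots> = M\<^sup>2 * exp (- a) * ((4 * a) ^ x /\<^sub>R fact x)"
      by (simp add: poisson_weight_def power_mult_distrib divide_inverse mult_ac)
    finally show ?thesis
      using poisson_weight_nonneg[OF assms(1), of x] by simp
  qed
  ultimately show ?thesis
    unfolding l2_space_def by (blast intro: summable_comparison_test')
qed

lemma charlier_exponential_bound:
  assumes "a > 0"
  obtains M where "\<And>x. \<bar>charlier a n x\<bar> \<le> M * 2 ^ x"
proof -
  have "\<bar>charlier_kernel a n x\<bar> \<le> (\<Sum>j\<le>n. real (n choose j) * fact j / a ^ j) * 2 ^ x" for x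
  proof -
    have "\<bar>charlier_kernel a n x\<bar>
        \<le> (\<Sum>j\<le>n. \<bar>(-1) ^ j * real (n choose j) * real (x choose j) * fact j / a ^ j\<bar>)"
      unfolding charlier_kernel_def by (rule sum_abs)
    also have "\<dots> = (\<Sum>j\<le>n. real (n choose j) * fact j / a ^ j * real (x choose j))"
      using assms by (intro sum.cong refl) (simp add: abs_mult power_abs)
    also have "\<dots> \<le> (\<Sum>j\<le>n. real (n choose j) * fact j / a ^ j * 2 ^ x)"
    proof (intro sum_mono mult_left_mono)
      fix j
      show "real (x choose j) \<le> 2 ^ x"
        using of_nat_mono[OF binomial_le_pow2[of x j], where 'a = real] by simp
    qed (use assms in simp)
    finally show ?thesis
      by (simp add: sum_distrib_right)
  qed
  from mult_left_mono[OF this] have "\<bar>charlier a n x\<bar>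
      \<le> sqrt (a ^ n / fact n) * (\<Sum>j\<le>n. real (n choose j) * fact j / a ^ j) * 2 ^ x" for x
    using assms by (simp add: charlier_eq_kernel abs_mult mult.assoc)
  then show ?thesis
    by (rule that)
qed

lemma charlier_shift_l2:
  assumes "a > 0"
  shows "(\<lambda>x. charlier a n (x + j)) \<in> l2_space (poisson_weight a)"
proof -
  obtain M where M: "\<And>x. \<bar>charlier a n x\<bar> \<le> M * 2 ^ x"
    using charlier_exponential_bound[OF assms, of n] by blast
  show ?thesis
    using M[of "_ + j"]
    by (intro l2_space_poisson_exponential_bound[OF assms, of _ "M * 2 ^ j"])
      (simp add: power_add mult_ac)
qed

lemma charlier_l2: "a > 0 \<Longrightarrow> charlier a n \<in> l2_space (poisson_weight a)"
  using charlier_shift_l2[of a n 0] by simp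

lemma charlier_scale_Suc:
  assumes "a > 0"
  shows "sqrt (a ^ n / fact n) = sqrt (real (Suc n) / a) * sqrt (a ^ Suc n / fact (Suc n))"
  using assms by (simp add: real_sqrt_mult[symmetric] del: of_nat_Suc)

lemma forward_diff_charlier:
  assumes "a > 0"
  shows "forward_diff (charlier a (Suc n)) x = - sqrt (real (Suc n) / a) * charlier a n x"
proof -
  define s where "s = sqrt (a ^ Suc n / fact (Suc n))"
  define t where "t = sqrt (real (Suc n) / a)"
  have tt: "real (Suc n) / a = t * t"
    using assms by (simp add: t_def)
  have "s * (charlier_kernel a (Suc n) (Suc x) - charlier_kernel a (Suc n) x)
      = - t * (t * s * charlier_kernel a n x)"
    unfolding charlier_kernel_diff_right[OF assms] tt by simp
  then show ?thesis
    unfolding forward_diff_def charlier_eq_kernel[OF assms]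
      charlier_scale_Suc[OF assms, of n] s_def[symmetric] t_def[symmetric]
    by (simp add: right_diff_distrib)
qed

text \<open>The left-hand side, minus \<open>charlier a n x\<close>, is the adjoint of the forward difference with
  respect to the Poisson weight. The factor \<open>real x\<close> makes the truncated subtraction at \<open>x = 0\<close>
  harmless.\<close>

lemma charlier_raising:
  assumes "a > 0"
  shows "real x / a * charlier a n (x - 1)
       = charlier a n x - sqrt (real (Suc n) / a) * charlier a (Suc n) x"
proof -
  have "real x / a * charlier_kernel a n (x - 1) = charlier_kernel a n x - charlier_kernel a (Suc n) x"
    using charlier_kernel_diff_left[OF assms, of n "x - 1"] by (cases x) auto
  then have "sqrt (a ^ n / fact n) * (real x / a * charlier_kernel a n (x - 1))
      = sqrt (a ^ n / fact n) * charlier_kernel a n x - sqrt (a ^ n / fact n) * charlier_kernel a (Suc n) x"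
    by (simp add: right_diff_distrib)
  also have "sqrt (a ^ n / fact n) * charlier_kernel a (Suc n) x
      = sqrt (real (Suc n) / a) * charlier a (Suc n) x"
    unfolding charlier_scale_Suc[OF assms, of n] charlier_eq_kernel[OF assms] by simp
  finally show ?thesis
    by (simp add: charlier_eq_kernel[OF assms] mult_ac)
qed

text \<open>Summation by parts: \<open>(x + 1) w (x + 1) = a w x\<close> moves the shift from \<open>q\<close> to the
  Charlier polynomial, where it becomes the raising operator.\<close>

lemma forward_diff_coeff:
  assumes a: "a > 0" and q: "q \<in> l2_space (poisson_weight a)"
    and q': "(\<lambda>x. q (Suc x)) \<in> l2_space (poisson_weight a)"
  shows "weighted_inner (poisson_weight a) (forward_diff q) (charlier a n)
       = - sqrt (real (Suc n) / a) * weighted_inner (poisson_weight a) q (charlier a (Suc n))"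
proof -
  let ?w = "poisson_weight a" and ?t = "sqrt (real (Suc n) / a)"
  note w = poisson_weight_nonneg[OF a]
  note C = charlier_l2[OF a]
  define f where "f = (\<lambda>x. q x * (real x / a * charlier a n (x - 1)) * ?w x)"
  have f_Suc: "f (Suc x) = q (Suc x) * charlier a n x * ?w x" for x
  proof -
    have "f (Suc x) = q (Suc x) * charlier a n x * (real (Suc x) * ?w (Suc x)) / a"
      by (simp add: f_def del: of_nat_Suc)
    then show ?thesis
      using a unfolding poisson_weight_Suc by simp
  qed
  have f_split: "f x = q x * charlier a n x * ?w x - ?t * (q x * charlier a (Suc n) x * ?w x)" for x
    unfolding f_def charlier_raising[OF a] by (simp add: algebra_simps)
  note sm = l2_space_product_summable[OF w q C]
  have "f sums (weighted_inner ?w q (charlier a n) - ?t * weighted_inner ?w q (charlier a (Suc n)))"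
    unfolding f_split weighted_inner_def using sm
    by (intro sums_diff sums_mult summable_sums)
  moreover have "f sums weighted_inner ?w (\<lambda>x. q (Suc x)) (charlier a n)"
  proof -
    have "(\<lambda>x. f (Suc x)) sums weighted_inner ?w (\<lambda>x. q (Suc x)) (charlier a n)"
      unfolding f_Suc weighted_inner_def
      using l2_space_product_summable[OF w q' C] by (rule summable_sums)
    then show ?thesis
      using sums_Suc[of f] by (simp add: f_def)
  qed
  ultimately have "weighted_inner ?w (\<lambda>x. q (Suc x)) (charlier a n)
      = weighted_inner ?w q (charlier a n) - ?t * weighted_inner ?w q (charlier a (Suc n))"
    by (rule sums_unique2[symmetric])
  then show ?thesis
    using weighted_inner_diff_left[OF w q' q C] by (simp add: forward_diff_def[abs_def])
qed

text \<open>Evaluating the inner product of a difference of one Charlier polynomial with another, directly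
  and through the adjoint, reduces both indices by one; the constants are annihilated by the
  difference operator, which settles the case where one index is zero.\<close>

lemma charlier_orthonormal:
  assumes a: "a > 0"
  shows "weighted_inner (poisson_weight a) (charlier a i) (charlier a j) = (if i = j then 1 else 0)"
proof -
  let ?g = "\<lambda>i j. weighted_inner (poisson_weight a) (charlier a i) (charlier a j)"
  note w = poisson_weight_nonneg[OF a]
  note C = charlier_l2[OF a]
  have adj: "weighted_inner (poisson_weight a) (forward_diff (charlier a i)) (charlier a j)
      = - sqrt (real (Suc j) / a) * ?g i (Suc j)" for i j
    using charlier_shift_l2[OF a, of i 1] by (intro forward_diff_coeff a C) simp
  have zero: "?g 0 (Suc j) = 0" for j
  proof -
    have "forward_diff (charlier a 0) = (\<lambda>x. 0)"
      by (simp add: forward_diff_def fun_eq_iff)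
    then show ?thesis
      using adj[of 0 j] a by (simp add: weighted_inner_def del: of_nat_Suc)
  qed
  have step: "sqrt (real (Suc i) / a) * ?g i j = sqrt (real (Suc j) / a) * ?g (Suc i) (Suc j)" for i j
  proof -
    have "forward_diff (charlier a (Suc i)) = (\<lambda>x. - sqrt (real (Suc i) / a) * charlier a i x)"
      by (intro ext forward_diff_charlier a)
    then show ?thesis
      using adj[of "Suc i" j] weighted_inner_scale_left[OF w C[of i] C[of j], of "- sqrt (real (Suc i) / a)"]
      by simp
  qed
  show ?thesis
  proof (induction i arbitrary: j)
    case 0
    show ?case
    proof (cases j)
      case 0
      then show ?thesis
        using sums_unique[OF poisson_weight_sums[of a], symmetric] by (simp add: weighted_inner_def)
    qed (use zero in \<open>simp del: charlier.simps\<close>)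
  next
    case (Suc i)
    show ?case
    proof (cases j)
      case 0
      then show ?thesis
        using zero[of i] weighted_inner_commute[of _ "charlier a 0" "charlier a (Suc i)"]
        by (simp del: charlier.simps)
    next
      case (Suc j')
      have "sqrt (real (Suc j') / a) > 0"
        using a by (simp del: of_nat_Suc)
      then show ?thesis
        using step[of i j'] Suc.IH[of j'] Suc by (auto simp del: of_nat_Suc charlier.simps)
    qed
  qed
qed

text \<open>Since the kernel is symmetric, the infinite matrix with entries
  \<open>charlier a n x * sqrt (poisson_weight a x)\<close> is symmetric; its rows being orthonormal, so are its
  columns.\<close>

lemma charlier_dual_orthogonal:
  assumes a: "a > 0"
  shows "(\<lambda>n. charlier a n x * charlier a n y) sums (if x = y then 1 / poisson_weight a x else 0)"
proof -
  let ?s = "\<lambda>n. sqrt (a ^ n / fact n)"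
  have s: "?s n > 0" "?s n * ?s n = a ^ n / fact n" for n
    using a by auto
  have "(\<lambda>n. charlier a x n * charlier a y n * poisson_weight a n) sums (if x = y then 1 else 0)"
    using summable_sums[OF l2_space_product_summable[OF poisson_weight_nonneg[OF a]
        charlier_l2[OF a] charlier_l2[OF a], of x y]] charlier_orthonormal[OF a, of x y]
    by (simp add: weighted_inner_def)
  then have "(\<lambda>n. charlier a x n * charlier a y n * poisson_weight a n * (exp a / (?s x * ?s y)))
      sums ((if x = y then 1 else 0) * (exp a / (?s x * ?s y)))"
    by (rule sums_mult2)
  moreover have "charlier a x n * charlier a y n * poisson_weight a n * (exp a / (?s x * ?s y))
      = charlier a n x * charlier a n y" for n
  proof -
    have "charlier a n x * charlier a n y
        = a ^ n / fact n * charlier_kernel a x n * charlier_kernel a y n"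
      using s(2)[of n] unfolding charlier_eq_kernel[OF a] charlier_kernel_commute[of a n]
      by (simp add: mult_ac)
    moreover have "exp (- a) * exp a = 1" "a \<noteq> 0"
      using a by (simp_all flip: exp_add)
    ultimately show ?thesis
      using s(1)[of x] s(1)[of y]
      by (simp add: charlier_eq_kernel[OF a] poisson_weight_def del: real_sqrt_gt_0_iff)
  qed
  moreover have "(if x = y then 1 else 0) * (exp a / (?s x * ?s y))
      = (if x = y then 1 / poisson_weight a x else 0)"
    using s(2)[of x] by (auto simp: poisson_weight_def exp_minus divide_simps)
  ultimately show ?thesis by simp
qed

text \<open>For the truncation \<open>u\<close> of \<open>q\<close> to \<open>x < X\<close> the identity is the dual orthogonality. The
  coefficients of \<open>u\<close> differ from those of \<open>q\<close> by the coefficients of the tail \<open>v\<close>, whose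
  square sum is at most the squared norm of \<open>v\<close> by Bessel's inequality, and that norm tends to
  zero. The parameter \<open>z < 1\<close> pays for the mixed terms and goes to \<open>1\<close> at the end.\<close>

lemma charlier_parseval:
  assumes a: "a > 0" and q: "q \<in> l2_space (poisson_weight a)"
  shows "(\<lambda>n. (weighted_inner (poisson_weight a) q (charlier a n))\<^sup>2)
           sums weighted_inner (poisson_weight a) q q"
proof -
  let ?w = "poisson_weight a"
  let ?c = "\<lambda>q n. weighted_inner ?w q (charlier a n)"
  note w = poisson_weight_nonneg[OF a]
  note C = charlier_l2[OF a]
  note bes = bessel[OF w C charlier_orthonormal[OF a]]
  define S where "S = (\<Sum>n. (?c q n)\<^sup>2)"
  define P where "P = (\<lambda>X. \<Sum>x<X. (q x)\<^sup>2 * ?w x)"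
  define E where "E = weighted_inner ?w q q"
  have P_lim: "P \<longlonglongrightarrow> E"
    using summable_LIMSEQ[of "\<lambda>x. (q x)\<^sup>2 * ?w x"] q
    by (simp add: P_def E_def l2_space_def weighted_inner_def power2_eq_square)
  have trunc: "z * P X \<le> S + z / (1 - z) * (E - P X)" if z: "0 < z" "z < 1" for z X
  proof -
    define u where "u = (\<lambda>x. if x < X then q x else 0)"
    define v where "v = (\<lambda>x. if x < X then 0 else q x)"
    have v_l2: "v \<in> l2_space ?w"
    proof -
      have "summable (\<lambda>x. (v x)\<^sup>2 * ?w x)"
        by (rule summable_comparison_test'[of "\<lambda>x. (q x)\<^sup>2 * ?w x"])
          (use q w in \<open>auto simp: v_def l2_space_def\<close>)
      then show ?thesis by (simp add: l2_space_def)
    qed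
    have cu: "?c u n = ?c q n - ?c v n" for n
    proof -
      have "u = (\<lambda>x. q x - v x)"
        by (auto simp: u_def v_def)
      then show ?thesis
        using weighted_inner_diff_left[OF w q v_l2 C] by simp
    qed
    have cu_finite: "?c u n = (\<Sum>x<X. q x * ?w x * charlier a n x)" for n
      unfolding weighted_inner_def u_def
      by (subst suminf_finite[of "{..<X}"]) (auto intro!: sum.cong)
    have "(\<lambda>n. (?c u n)\<^sup>2) sums P X"
    proof -
      have "(\<lambda>n. \<Sum>x<X. \<Sum>y<X. (q x * ?w x) * (q y * ?w y) * (charlier a n x * charlier a n y))
          sums (\<Sum>x<X. \<Sum>y<X. (q x * ?w x) * (q y * ?w y) * (if x = y then 1 / ?w x else 0))"
        by (intro sums_sum sums_mult charlier_dual_orthogonal a)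
      moreover have "(?c u n)\<^sup>2
          = (\<Sum>x<X. \<Sum>y<X. (q x * ?w x) * (q y * ?w y) * (charlier a n x * charlier a n y))" for n
        unfolding cu_finite power2_eq_square sum_product by (simp add: mult_ac)
      moreover have "(\<Sum>x<X. \<Sum>y<X. (q x * ?w x) * (q y * ?w y) * (if x = y then 1 / ?w x else 0))
          = P X"
        unfolding P_def
      proof (intro sum.cong refl)
        fix x assume "x \<in> {..<X}"
        then have "(\<Sum>y<X. (q x * ?w x) * (q y * ?w y) * (if x = y then 1 / ?w x else 0))
            = (q x * ?w x) * (q x * ?w x) * (1 / ?w x)"
          by (simp add: if_distrib[of "\<lambda>t. _ * t"] sum.delta cong: if_cong)
        then show "(\<Sum>y<X. (q x * ?w x) * (q y * ?w y) * (if x = y then 1 / ?w x else 0))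
            = (q x)\<^sup>2 * ?w x"
          using poisson_weight_pos[OF a, of x] by (simp add: power2_eq_square)
      qed
      ultimately show ?thesis by simp
    qed
    then have lhs: "(\<lambda>n. z * (?c u n)\<^sup>2) sums (z * P X)"
      by (rule sums_mult)
    have rhs: "(\<lambda>n. (?c q n)\<^sup>2 + z / (1 - z) * (?c v n)\<^sup>2)
        sums (S + z / (1 - z) * (\<Sum>n. (?c v n)\<^sup>2))"
      unfolding S_def by (intro sums_add sums_mult summable_sums bes(1) q v_l2)
    have "z * (b - c)\<^sup>2 \<le> b\<^sup>2 + z / (1 - z) * c\<^sup>2" for b c
    proof -
      \<comment> \<open>the difference of the two sides is a perfect square up to the factor \<open>1 / (1 - z)\<close>\<close>
      have "0 \<le> ((1 - z) * b + z * c)\<^sup>2 / (1 - z)"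
        using z by simp
      also have "\<dots> = b\<^sup>2 + z / (1 - z) * c\<^sup>2 - z * (b - c)\<^sup>2"
        using z by (simp add: divide_simps) (simp add: algebra_simps power2_eq_square)
      finally show ?thesis by simp
    qed
    then have "z * P X \<le> S + z / (1 - z) * (\<Sum>n. (?c v n)\<^sup>2)"
      by (intro sums_le[OF _ lhs rhs]) (simp add: cu)
    also have "\<dots> \<le> S + z / (1 - z) * weighted_inner ?w v v"
      using z bes(2)[OF v_l2] by (intro add_left_mono mult_left_mono) auto
    also have "weighted_inner ?w v v = E - P X"
    proof -
      have 1: "(\<lambda>x. (q x)\<^sup>2 * ?w x) sums E"
        using q by (simp add: E_def l2_space_def weighted_inner_def power2_eq_square summable_sums)
      have "(\<lambda>x. (if x \<in> {..<X} then (q x)\<^sup>2 * ?w x else 0)) sums P X"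
        unfolding P_def by (rule sums_If_finite_set) simp
      from sums_diff[OF 1 this]
      have "(\<lambda>x. v x * v x * ?w x) sums (E - P X)"
        by (rule back_subst[of "\<lambda>f. f sums _"]) (auto simp: v_def power2_eq_square)
      then show ?thesis
        unfolding weighted_inner_def by (rule sums_unique[symmetric])
    qed
    finally show ?thesis .
  qed
  have "z * E \<le> S" if z: "0 < z" "z < 1" for z
  proof -
    have 1: "(\<lambda>X. z * P X) \<longlonglongrightarrow> z * E"
      by (intro tendsto_intros P_lim)
    have "(\<lambda>X. S + z / (1 - z) * (E - P X)) \<longlonglongrightarrow> S + z / (1 - z) * (E - E)"
      using z by (intro tendsto_intros P_lim)
    then show ?thesis
      using LIMSEQ_le[OF 1, of "\<lambda>X. S + z / (1 - z) * (E - P X)"] trunc[OF z] by simp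
  qed
  then have "E \<le> S"
    by (rule field_le_mult_one_interval)
  then have "S = E"
    using bes(2)[OF q] by (simp add: S_def E_def)
  then show ?thesis
    using summable_sums[OF bes(1)[OF q]] by (simp add: S_def E_def)
qed

section \<open>Falling powers and iterated differences\<close>

lemma falling_power_eq_0: "n < i \<Longrightarrow> falling_power n i = 0"
  by (auto simp: falling_power_def)

lemma falling_power_nonneg: "falling_power n i \<ge> 0"
proof (cases "n < i")
  case False
  then show ?thesis
    unfolding falling_power_def by (intro prod_nonneg) auto
qed (simp add: falling_power_eq_0)

lemma falling_power_Suc_Suc: "falling_power (Suc n) (Suc i) = real (Suc n) * falling_power n i"
  unfolding falling_power_def prod.lessThan_Suc_shift by simp

lemma falling_power_le_power: "falling_power n i \<le> real n ^ i"
proof (cases "n < i")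
  case False
  then have "falling_power n i \<le> (\<Prod>j<i. real n)"
    unfolding falling_power_def by (intro prod_mono) auto
  then show ?thesis by simp
qed (simp add: falling_power_eq_0)

text \<open>Each factor satisfies \<open>n \<le> m (n - i)\<close>, because \<open>(m - 1) (n - m) \<ge> 0\<close> and
  \<open>i \<le> m - 1\<close>.\<close>

lemma power_le_falling_power:
  assumes "m \<le> n"
  shows "real n ^ m \<le> real m ^ m * falling_power n m"
proof -
  have "(\<Prod>i<m. real n) \<le> (\<Prod>i<m. real m * (real n - real i))"
  proof (intro prod_mono conjI)
    fix i assume i: "i \<in> {..<m}"
    have "0 \<le> (real m - 1) * (real n - real m)"
      using i assms by (intro mult_nonneg_nonneg) auto
    also have "\<dots> = real m * (real n - (real m - 1)) - real n"
      by (simp add: algebra_simps)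
    also have "\<dots> \<le> real m * (real n - real i) - real n"
      using i by (intro diff_right_mono mult_left_mono) auto
    finally show "real n \<le> real m * (real n - real i)"
      by simp
  qed simp
  then show ?thesis
    by (simp add: falling_power_def prod.distrib)
qed

lemma falling_power_weight:
  "falling_power (x + k) k * poisson_weight a (x + k) = a ^ k * poisson_weight a x"
proof (induction k)
  case 0
  show ?case by (simp add: falling_power_def)
next
  case (Suc k)
  have "falling_power (x + Suc k) (Suc k) * poisson_weight a (x + Suc k)
      = falling_power (x + k) k * (real (Suc (x + k)) * poisson_weight a (Suc (x + k)))"
    by (simp add: falling_power_Suc_Suc del: of_nat_Suc)
  then show ?case
    unfolding poisson_weight_Suc using Suc by (simp add: mult_ac)
qed

lemma power2_add_le: "((u::real) + v)\<^sup>2 \<le> 2 * u\<^sup>2 + 2 * v\<^sup>2"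
  using zero_le_power2[of "u - v"] by (simp add: power2_sum power2_diff)

lemma iterated_diff_le_shifts:
  "((forward_diff ^^ i) f x)\<^sup>2 \<le> 4 ^ i * (\<Sum>j\<le>i. (f (x + j))\<^sup>2)"
proof (induction i arbitrary: x)
  case 0
  show ?case by simp
next
  case (Suc i)
  let ?D = "(forward_diff ^^ i) f" and ?S = "\<Sum>j\<le>Suc i. (f (x + j))\<^sup>2"
  have 1: "(?D x)\<^sup>2 \<le> 4 ^ i * ?S"
    using Suc[of x] by (rule order_trans) (intro mult_left_mono sum_mono2, auto)
  have 2: "(?D (Suc x))\<^sup>2 \<le> 4 ^ i * ?S"
    using Suc[of "Suc x"] by (rule order_trans) (simp add: sum.atMost_Suc_shift del: sum.atMost_Suc)
  have "((forward_diff ^^ Suc i) f x)\<^sup>2 = (?D (Suc x) + - ?D x)\<^sup>2"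
    by (simp add: forward_diff_def)
  also have "\<dots> \<le> 2 * (?D (Suc x))\<^sup>2 + 2 * (- ?D x)\<^sup>2"
    by (rule power2_add_le)
  also have "\<dots> \<le> 4 ^ Suc i * ?S"
    using 1 2 by simp
  finally show ?case .
qed

text \<open>A shift is the identity plus a forward difference. In each of the \<open>j\<close> steps the squares
  double and two sums, each contained in the larger one, are added: a factor \<open>4\<close>.\<close>

lemma shift_le_iterated_diffs:
  "(f (x + j))\<^sup>2 \<le> 4 ^ j * (\<Sum>i\<le>j. ((forward_diff ^^ i) f x)\<^sup>2)"
proof (induction j arbitrary: f)
  case 0
  show ?case by simp
next
  case (Suc j)
  let ?S = "\<Sum>i\<le>Suc j. ((forward_diff ^^ i) f x)\<^sup>2"
  have 1: "(f (x + j))\<^sup>2 \<le> 4 ^ j * ?S"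
    using Suc[of f] by (rule order_trans) (intro mult_left_mono sum_mono2, auto)
  have 2: "(forward_diff f (x + j))\<^sup>2 \<le> 4 ^ j * ?S"
    using Suc[of "forward_diff f"]
    by (rule order_trans)
      (simp add: sum.atMost_Suc_shift funpow_Suc_right del: sum.atMost_Suc funpow.simps)
  have "(f (x + Suc j))\<^sup>2 = (f (x + j) + forward_diff f (x + j))\<^sup>2"
    by (simp add: forward_diff_def)
  also have "\<dots> \<le> 2 * (f (x + j))\<^sup>2 + 2 * (forward_diff f (x + j))\<^sup>2"
    by (rule power2_add_le)
  also have "\<dots> \<le> 4 ^ Suc j * ?S"
    using 1 2 by simp
  finally show ?case .
qed

section \<open>Sobolev norms as sums over shifts and over differences\<close>

lemma weighted_inner_self_bound:
  assumes v: "\<And>x. v x \<ge> 0" and f: "f \<in> l2_space v" and g: "\<And>i. i \<in> I \<Longrightarrow> g i \<in> l2_space v"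
    and le: "\<And>x. (f x)\<^sup>2 \<le> c * (\<Sum>i\<in>I. (g i x)\<^sup>2)"
  shows "weighted_inner v f f \<le> c * (\<Sum>i\<in>I. weighted_inner v (g i) (g i))"
proof -
  have upper: "(\<lambda>x. c * (\<Sum>i\<in>I. g i x * g i x * v x)) sums (c * (\<Sum>i\<in>I. weighted_inner v (g i) (g i)))"
    unfolding weighted_inner_def
    by (intro sums_mult sums_sum summable_sums l2_space_product_summable v g)
  have lower: "(\<lambda>x. f x * f x * v x) sums weighted_inner v f f"
    unfolding weighted_inner_def by (intro summable_sums l2_space_product_summable v f)
  have "f x * f x * v x \<le> c * (\<Sum>i\<in>I. g i x * g i x * v x)" for x
    using mult_right_mono[OF le[of x] v[of x]]
    by (simp add: power2_eq_square sum_distrib_right mult.assoc)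
  then show ?thesis
    using lower upper by (rule sums_le)
qed

lemma iterated_diff_l2:
  assumes "a > 0" "\<And>j. j \<le> i \<Longrightarrow> (\<lambda>x. q (x + j)) \<in> l2_space (poisson_weight a)"
  shows "(forward_diff ^^ i) q \<in> l2_space (poisson_weight a)"
  using assms(2)
proof (induction i arbitrary: q)
  case 0
  then show ?case by simp
next
  case (Suc i)
  have "(\<lambda>x. forward_diff q (x + j)) \<in> l2_space (poisson_weight a)" if "j \<le> i" for j
    using l2_space_diff[OF poisson_weight_nonneg[OF assms(1)] Suc.prems[of "Suc j"] Suc.prems[of j]] that
    by (simp add: forward_diff_def)
  then show ?case
    using Suc.IH[of "forward_diff q"] by (simp add: funpow_Suc_right del: funpow.simps)
qed

lemma iterated_diff_coeff:
  assumes a: "a > 0" and q: "\<And>j. j \<le> i \<Longrightarrow> (\<lambda>x. q (x + j)) \<in> l2_space (poisson_weight a)"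
  shows "(weighted_inner (poisson_weight a) ((forward_diff ^^ i) q) (charlier a n))\<^sup>2
       = falling_power (n + i) i / a ^ i * (weighted_inner (poisson_weight a) q (charlier a (n + i)))\<^sup>2"
  using q
proof (induction i arbitrary: q)
  case 0
  then show ?case by (simp add: falling_power_def)
next
  case (Suc i)
  let ?c = "\<lambda>q n. weighted_inner (poisson_weight a) q (charlier a n)"
  have "(\<lambda>x. forward_diff q (x + j)) \<in> l2_space (poisson_weight a)" if "j \<le> i" for j
    using l2_space_diff[OF poisson_weight_nonneg[OF a] Suc.prems[of "Suc j"] Suc.prems[of j]] that
    by (simp add: forward_diff_def)
  then have "(?c ((forward_diff ^^ i) (forward_diff q)) n)\<^sup>2
      = falling_power (n + i) i / a ^ i * (?c (forward_diff q) (n + i))\<^sup>2"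
    by (rule Suc.IH)
  also have "?c (forward_diff q) (n + i) = - sqrt (real (Suc (n + i)) / a) * ?c q (Suc (n + i))"
    using Suc.prems[of 0] Suc.prems[of 1] by (intro forward_diff_coeff a) simp_all
  also have "(\<dots>)\<^sup>2 = real (Suc (n + i)) / a * (?c q (Suc (n + i)))\<^sup>2"
    using a by (simp add: power_mult_distrib del: of_nat_Suc)
  also have "falling_power (n + i) i / a ^ i * \<dots>
      = falling_power (n + Suc i) (Suc i) / a ^ Suc i * (?c q (n + Suc i))\<^sup>2"
    by (simp add: falling_power_Suc_Suc mult_ac del: of_nat_Suc charlier.simps)
  finally show ?case
    by (simp add: funpow_Suc_right del: funpow.simps)
qed

text \<open>Each difference lowers the index of the coefficients by one, so Parseval's identity for the
  \<open>i\<close>-th difference is a series over the indices \<open>n + i\<close>; the terms below index \<open>i\<close> vanish.\<close>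

lemma iterated_diff_parseval:
  assumes a: "a > 0" and q: "\<And>j. j \<le> i \<Longrightarrow> (\<lambda>x. q (x + j)) \<in> l2_space (poisson_weight a)"
  shows "(\<lambda>n. falling_power n i / a ^ i * (weighted_inner (poisson_weight a) q (charlier a n))\<^sup>2)
    sums weighted_inner (poisson_weight a) ((forward_diff ^^ i) q) ((forward_diff ^^ i) q)"
proof -
  have "(\<lambda>n. falling_power (n + i) i / a ^ i
      * (weighted_inner (poisson_weight a) q (charlier a (n + i)))\<^sup>2)
    sums weighted_inner (poisson_weight a) ((forward_diff ^^ i) q) ((forward_diff ^^ i) q)"
    using charlier_parseval[OF a iterated_diff_l2[OF a q]] by (simp add: iterated_diff_coeff[OF a q])
  then show ?thesis
    by (subst (asm) sums_iff_shift) (simp add: falling_power_eq_0)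
qed

text \<open>The factor \<open>x\<close> falling \<open>k\<close> kills the first \<open>k\<close> terms and turns the Poisson weight at \<open>x\<close>
  into the one at \<open>x - k\<close>.\<close>

lemma falling_power_sums_iff_shift:
  fixes p :: "nat \<Rightarrow> real"
  assumes a: "a > 0"
  defines "q \<equiv> \<lambda>x. p x * poisson_weight_inv a x"
  shows "(\<lambda>x. falling_power x k * (p x)\<^sup>2 * poisson_weight_inv a x) sums s
    \<longleftrightarrow> (\<lambda>x. a ^ k * ((q (x + k))\<^sup>2 * poisson_weight a x)) sums s"
proof -
  define f where "f = (\<lambda>x. falling_power x k * (p x)\<^sup>2 * poisson_weight_inv a x)"
  have "f (x + k) = a ^ k * ((q (x + k))\<^sup>2 * poisson_weight a x)" for x
  proof -
    have "(p (x + k))\<^sup>2 * poisson_weight_inv a (x + k) = (q (x + k))\<^sup>2 * poisson_weight a (x + k)"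
      using poisson_weight_pos[OF a, of "x + k"]
      by (simp add: q_def poisson_weight_inv_def power2_eq_square)
    then have "f (x + k) = (q (x + k))\<^sup>2 * (falling_power (x + k) k * poisson_weight a (x + k))"
      by (simp add: f_def mult.assoc mult.left_commute)
    then show ?thesis
      by (simp add: falling_power_weight mult_ac)
  qed
  moreover have "(\<Sum>x<k. f x) = 0"
    by (simp add: f_def falling_power_eq_0)
  ultimately show ?thesis
    using sums_iff_shift[of f k s] by (simp add: f_def)
qed

lemma h_space_iff_shifts:
  assumes a: "a > 0"
  shows "p \<in> h_space m (poisson_weight_inv a) \<longleftrightarrow>
    (\<forall>k\<le>m. (\<lambda>x. p (x + k) * poisson_weight_inv a (x + k)) \<in> l2_space (poisson_weight a))"
proof -
  have "(\<lambda>x. sqrt (falling_power x k) * p x) \<in> l2_space (poisson_weight_inv a) \<longleftrightarrow>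
    (\<lambda>x. p (x + k) * poisson_weight_inv a (x + k)) \<in> l2_space (poisson_weight a)" for k
  proof -
    have "summable (\<lambda>x. falling_power x k * (p x)\<^sup>2 * poisson_weight_inv a x) \<longleftrightarrow>
      summable (\<lambda>x. a ^ k * ((p (x + k) * poisson_weight_inv a (x + k))\<^sup>2 * poisson_weight a x))"
      unfolding summable_def falling_power_sums_iff_shift[OF a] ..
    then show ?thesis
      using a by (simp add: l2_space_def power_mult_distrib[of "sqrt _"] falling_power_nonneg
          summable_cmult_iff)
  qed
  then show ?thesis
    by (simp add: h_space_def)
qed

lemma h_norm_eq_shifts:
  assumes a: "a > 0" and p: "p \<in> h_space m (poisson_weight_inv a)"
  shows "h_norm a m (poisson_weight_inv a) p = sqrt (\<Sum>k\<le>m. weighted_inner (poisson_weight a)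
          (\<lambda>x. p (x + k) * poisson_weight_inv a (x + k)) (\<lambda>x. p (x + k) * poisson_weight_inv a (x + k)))"
proof -
  have "inverse (a ^ k) * (\<Sum>x. falling_power x k * (p x)\<^sup>2 * poisson_weight_inv a x)
      = weighted_inner (poisson_weight a)
          (\<lambda>x. p (x + k) * poisson_weight_inv a (x + k)) (\<lambda>x. p (x + k) * poisson_weight_inv a (x + k))"
    if "k \<le> m" for k
  proof -
    let ?q = "\<lambda>x. p (x + k) * poisson_weight_inv a (x + k)"
    have "(\<lambda>x. (?q x)\<^sup>2 * poisson_weight a x) sums weighted_inner (poisson_weight a) ?q ?q"
      using p that unfolding h_space_iff_shifts[OF a] l2_space_def weighted_inner_def
      by (simp add: power2_eq_square summable_sums)
    then have "(\<lambda>x. falling_power x k * (p x)\<^sup>2 * poisson_weight_inv a x)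
        sums (a ^ k * weighted_inner (poisson_weight a) ?q ?q)"
      unfolding falling_power_sums_iff_shift[OF a] by (rule sums_mult)
    from sums_unique[OF this, symmetric] show ?thesis
      using a by simp
  qed
  then show ?thesis
    by (simp add: h_norm_def)
qed

section \<open>The projection error\<close>

text \<open>Write \<open>g\<^sub>i\<close> for \<open>falling_power n i / a ^ i\<close>. If \<open>m \<le> n\<close>, then \<open>g\<^sub>i\<close> is at most
  \<open>(n/a)\<^sup>i\<close>, and \<open>m\<^sup>m g\<^sub>m\<close> is at least \<open>(n/a)\<^sup>m\<close>; the quotient of these two bounds,
  \<open>a/n\<close> to the power \<open>m - i\<close>, is largest at \<open>n = N\<close>. If \<open>n < m\<close>, then \<open>g\<^sub>m = 0\<close>, but
  \<open>g\<^sub>i\<close> itself is one of the summands on the right, and its factor is at least \<open>1\<close>: since \<open>N < m\<close>,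
  the second condition on \<open>K\<close> absorbs \<open>(a/N)\<^sup>m\<close> when \<open>a < N\<close>.\<close>

lemma spectral_tail_bound:
  assumes a: "a > 0" and "k \<le> m" "i \<le> k" "1 \<le> N" "N \<le> n"
    and K: "K \<ge> real m ^ m" "K * a ^ m \<ge> real m ^ m"
  shows "falling_power n i / a ^ i \<le> K * ((a / real N) ^ m * (max 1 (real N / a)) ^ k)
           * (\<Sum>l\<le>m. falling_power n l / a ^ l)"
proof -
  define R where "R = (a / real N) ^ m * (max 1 (real N / a)) ^ k"
  define G where "G = (\<Sum>l\<le>m. falling_power n l / a ^ l)"
  have N: "real N > 0"
    using assms by simp
  have R0: "R \<ge> 0"
    using a N by (simp add: R_def)
  have K0: "K \<ge> 0"
    using K(1) by (meson order_trans of_nat_0_le_iff zero_le_power)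
  have G: "falling_power n l / a ^ l \<le> G" if "l \<le> m" for l
    unfolding G_def using that a
    by (intro member_le_sum) (auto simp: falling_power_nonneg)
  have G0: "G \<ge> 0"
    unfolding G_def using a by (intro sum_nonneg) (simp add: falling_power_nonneg)
  have "falling_power n i / a ^ i \<le> K * R * G"
  proof (cases "m \<le> n")
    case True
    have "(a / real n) ^ (m - i) \<le> (a / real N) ^ (m - i)"
      using a N assms by (intro power_mono divide_left_mono) auto
    also have "\<dots> = (a / real N) ^ m * (real N / a) ^ i"
      using a N assms by (simp add: power_diff power_divide)
    also have "(real N / a) ^ i \<le> (max 1 (real N / a)) ^ i"
      using a by (intro power_mono) auto
    also have "\<dots> \<le> (max 1 (real N / a)) ^ k"
      using assms by (intro power_increasing) auto
    finally have ratio: "(a / real n) ^ (m - i) \<le> R"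
      using a N by (simp add: R_def mult_left_mono)
    have "falling_power n i / a ^ i \<le> real n ^ i / a ^ i"
      using a by (intro divide_right_mono falling_power_le_power) auto
    also have "\<dots> = (a / real n) ^ (m - i) * (real n ^ m / a ^ m)"
      using a N assms by (simp add: power_diff power_divide)
    also have "\<dots> \<le> R * (real m ^ m * falling_power n m / a ^ m)"
      using a R0 by (intro mult_mono ratio divide_right_mono power_le_falling_power True) auto
    also have "\<dots> = R * (real m ^ m * (falling_power n m / a ^ m))"
      by simp
    also have "\<dots> \<le> R * (K * G)"
      using a R0 K0 K(1) by (intro mult_left_mono mult_mono G) (auto simp: falling_power_nonneg)
    finally show ?thesis by (simp add: mult_ac)
  next
    case False
    have m0: "real m ^ m \<ge> 1"
      using False by (intro one_le_power) simp
    have "1 \<le> K * R"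
    proof (cases "real N \<le> a")
      case True
      then have "1 \<le> R"
        unfolding R_def using N by (simp add: one_le_power)
      then show ?thesis
        using K(1) m0 mult_mono[of 1 K 1 R] by simp
    next
      case nle: False
      have "real N ^ m \<le> real m ^ m"
        using False assms by (intro power_mono) auto
      also have "\<dots> \<le> K * a ^ m" by (rule K(2))
      finally have "1 \<le> K * (a / real N) ^ m"
        using N by (simp add: power_divide field_simps)
      also have "\<dots> \<le> K * R"
        unfolding R_def using a K0 mult_left_mono[of 1 "(max 1 (real N / a)) ^ k" "(a / real N) ^ m"]
        by (intro mult_left_mono) (auto simp: one_le_power)
      finally show ?thesis .
    qed
    then have "1 * G \<le> K * R * G"
      using G0 by (rule mult_right_mono)
    then show ?thesis
      using G[of i] assms by simp
  qed
  then show ?thesis by (simp add: R_def G_def)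
qed

text \<open>The coefficients of the remainder are those of \<open>q\<close> with index at least \<open>N\<close>, so the comparison
  of spectral weights applies term by term. Passing from shifts to differences and back costs
  \<open>4\<^sup>m\<close> each time and, with the number of summands, produces the constant.\<close>

lemma remainder_shift_bound:
  fixes q :: "nat \<Rightarrow> real"
  assumes a: "a > 0" and km: "k \<le> m" and N: "1 \<le> N"
    and q: "\<forall>j\<le>m. (\<lambda>x. q (x + j)) \<in> l2_space (poisson_weight a)"
    and K: "K \<ge> real m ^ m" "K * a ^ m \<ge> real m ^ m"
  defines "r \<equiv> \<lambda>x. q x - (\<Sum>i<N. weighted_inner (poisson_weight a) q (charlier a i) * charlier a i x)"
  shows "\<And>j. j \<le> m \<Longrightarrow> (\<lambda>x. r (x + j)) \<in> l2_space (poisson_weight a)"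
    and "(\<Sum>j\<le>k. weighted_inner (poisson_weight a) (\<lambda>x. r (x + j)) (\<lambda>x. r (x + j)))
      \<le> (real (Suc m)) ^ 3 * 16 ^ m * K * ((a / real N) ^ m * (max 1 (real N / a)) ^ k)
        * (\<Sum>j\<le>m. weighted_inner (poisson_weight a) (\<lambda>x. q (x + j)) (\<lambda>x. q (x + j)))"
proof -
  let ?w = "poisson_weight a"
  let ?nsq = "\<lambda>f. weighted_inner ?w f f"
  let ?c = "\<lambda>q n. weighted_inner ?w q (charlier a n)"
  define R where "R = (a / real N) ^ m * (max 1 (real N / a)) ^ k"
  define A where "A = (\<Sum>j\<le>m. ?nsq (\<lambda>x. q (x + j)))"
  note w = poisson_weight_nonneg[OF a]
  note q = q[rule_format]
  have KR0: "K * R \<ge> 0"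
    using a order_trans[OF _ K(1), of 0] by (simp add: R_def)
  show r_l2: "(\<lambda>x. r (x + j)) \<in> l2_space ?w" if "j \<le> m" for j
    unfolding r_def using that
    by (intro l2_space_diff l2_space_sum l2_space_scale charlier_shift_l2 w q a) auto
  have cr: "?c r n = (if n < N then 0 else ?c q n)" for n
    unfolding r_def using q[of 0]
    by (intro orthonormal_remainder_inner w charlier_l2 charlier_orthonormal a) simp
  have diff_q: "?nsq ((forward_diff ^^ l) q) \<le> 4 ^ m * A" if "l \<le> m" for l
  proof -
    have "?nsq ((forward_diff ^^ l) q) \<le> 4 ^ l * (\<Sum>j\<le>l. ?nsq (\<lambda>x. q (x + j)))"
      using that by (intro weighted_inner_self_bound w iterated_diff_l2 a q iterated_diff_le_shifts) auto
    also have "\<dots> \<le> 4 ^ m * A"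
      unfolding A_def using that
      by (intro mult_mono power_increasing sum_mono2 sum_nonneg)
        (auto intro!: weighted_inner_self_nonneg w q)
    finally show ?thesis .
  qed
  have diff_r: "?nsq ((forward_diff ^^ i) r) \<le> K * R * (real (Suc m) * (4 ^ m * A))" if "i \<le> k" for i
  proof -
    have lower: "(\<lambda>n. falling_power n i / a ^ i * (?c r n)\<^sup>2) sums ?nsq ((forward_diff ^^ i) r)"
      using that km by (intro iterated_diff_parseval a r_l2) auto
    have upper: "(\<lambda>n. K * R * (\<Sum>l\<le>m. falling_power n l / a ^ l * (?c q n)\<^sup>2))
        sums (K * R * (\<Sum>l\<le>m. ?nsq ((forward_diff ^^ l) q)))"
      by (intro sums_mult sums_sum iterated_diff_parseval a q) auto
    have "falling_power n i / a ^ i * (?c r n)\<^sup>2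
        \<le> K * R * (\<Sum>l\<le>m. falling_power n l / a ^ l * (?c q n)\<^sup>2)" for n
    proof (cases "n < N")
      case True
      then show ?thesis
        using a KR0 by (auto simp: cr falling_power_nonneg intro!: mult_nonneg_nonneg sum_nonneg)
    next
      case False
      then have "falling_power n i / a ^ i \<le> K * R * (\<Sum>l\<le>m. falling_power n l / a ^ l)"
        unfolding R_def using that km N by (intro spectral_tail_bound a K) auto
      from mult_right_mono[OF this, of "(?c q n)\<^sup>2"] show ?thesis
        using False by (simp add: cr sum_distrib_right mult.assoc)
    qed
    then have "?nsq ((forward_diff ^^ i) r) \<le> K * R * (\<Sum>l\<le>m. ?nsq ((forward_diff ^^ l) q))"
      using lower upper by (rule sums_le)
    also have "\<dots> \<le> K * R * (\<Sum>l\<le>m. 4 ^ m * A)"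
      using KR0 diff_q by (intro mult_left_mono sum_mono) auto
    finally show ?thesis by simp
  qed
  define B where "B = K * R * (real (Suc m) * (4 ^ m * A))"
  have "A \<ge> 0"
    by (auto simp: A_def intro!: sum_nonneg weighted_inner_self_nonneg w q)
  then have B0: "B \<ge> 0"
    using KR0 by (simp add: B_def)
  have shift_r: "?nsq (\<lambda>x. r (x + j)) \<le> 4 ^ m * (real (Suc m) * B)" if j: "j \<le> k" for j
  proof -
    have "?nsq (\<lambda>x. r (x + j)) \<le> 4 ^ j * (\<Sum>i\<le>j. ?nsq ((forward_diff ^^ i) r))"
      using j km
      by (intro weighted_inner_self_bound w iterated_diff_l2 a r_l2 shift_le_iterated_diffs) auto
    also have "\<dots> \<le> 4 ^ j * (\<Sum>i\<le>j. B)"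
      using diff_r j by (intro mult_left_mono sum_mono) (auto simp: B_def)
    also have "\<dots> = 4 ^ j * (real (Suc j) * B)"
      by simp
    also have "\<dots> \<le> 4 ^ m * (real (Suc m) * B)"
      using B0 j km by (intro mult_mono power_increasing mult_right_mono mult_nonneg_nonneg) auto
    finally show ?thesis .
  qed
  have "(\<Sum>j\<le>k. ?nsq (\<lambda>x. r (x + j))) \<le> (\<Sum>j\<le>k. 4 ^ m * (real (Suc m) * B))"
    using shift_r by (intro sum_mono) auto
  also have "\<dots> = real (Suc k) * (4 ^ m * (real (Suc m) * B))"
    by simp
  also have "\<dots> \<le> real (Suc m) * (4 ^ m * (real (Suc m) * B))"
    using km B0 by (intro mult_right_mono mult_nonneg_nonneg) auto
  also have "\<dots> = real (Suc m) ^ 3 * 16 ^ m * K * R * A"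
  proof -
    have "(16::real) ^ m = 4 ^ m * 4 ^ m"
      by (simp flip: power_mult_distrib)
    then show ?thesis
      by (simp add: B_def power3_eq_cube mult_ac del: of_nat_Suc)
  qed
  finally show "(\<Sum>j\<le>k. ?nsq (\<lambda>x. r (x + j)))
      \<le> (real (Suc m)) ^ 3 * 16 ^ m * K * ((a / real N) ^ m * (max 1 (real N / a)) ^ k)
        * (\<Sum>j\<le>m. ?nsq (\<lambda>x. q (x + j)))"
    unfolding R_def A_def by (simp add: mult.assoc)
qed

lemma charlier_proj_error:
  fixes p :: "nat \<Rightarrow> real"
  assumes a: "a > 0" and N: "1 \<le> N"
  defines "q \<equiv> \<lambda>x. p x * poisson_weight_inv a x"
  shows "(charlier_proj a (N - 1) p x - p x) * poisson_weight_inv a x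
    = - (q x - (\<Sum>i<N. weighted_inner (poisson_weight a) q (charlier a i) * charlier a i x))"
proof -
  have inv: "poisson_weight a x * poisson_weight_inv a x = 1" for x
    using poisson_weight_pos[OF a, of x] by (simp add: poisson_weight_inv_def)
  have c: "weighted_inner (poisson_weight_inv a) p (charlier_fun a n)
      = weighted_inner (poisson_weight a) q (charlier a n)" for n
    unfolding weighted_inner_def q_def charlier_fun_def by (simp add: mult_ac)
  have "{..N - 1} = {..<N}"
    using N by auto
  then have "charlier_proj a (N - 1) p x * poisson_weight_inv a x
      = (\<Sum>i<N. weighted_inner (poisson_weight a) q (charlier a i) * charlier a i x)"
    unfolding charlier_proj_def c charlier_fun_def sum_distrib_right
    using inv[of x] by (simp add: mult.assoc)
  then show ?thesis
    by (simp add: q_def left_diff_distrib)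
qed

text \<open>The condition \<open>K * a ^ m \<ge> real m ^ m\<close> is how \<open>a\<close> enters the constant: it follows from \<open>K \<ge> real m ^ m\<close> as soon as \<open>a \<ge> 1\<close>, which makes the bound uniform
  there.\<close>

lemma charlier_proj_error_bound:
  assumes a: "a > 0" and k: "k \<le> m" and N: "1 \<le> N" and p: "p \<in> h_space m (poisson_weight_inv a)"
    and K: "K \<ge> real m ^ m" "K * a ^ m \<ge> real m ^ m"
  shows "(\<lambda>x. charlier_proj a (N - 1) p x - p x) \<in> h_space k (poisson_weight_inv a) \<and>
      h_norm a k (poisson_weight_inv a) (\<lambda>x. charlier_proj a (N - 1) p x - p x)
        \<le> sqrt ((real (Suc m)) ^ 3 * 16 ^ m * K) * (a / real N) powr (real m / 2)
          * (max 1 (real N / a)) powr (real k / 2) * h_norm a m (poisson_weight_inv a) p"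
proof -
  let ?w = "poisson_weight a" and ?M = "max 1 (real N / a)"
  define q where "q = (\<lambda>x. p x * poisson_weight_inv a x)"
  define r where "r = (\<lambda>x. q x - (\<Sum>i<N. weighted_inner ?w q (charlier a i) * charlier a i x))"
  have q: "\<forall>j\<le>m. (\<lambda>x. q (x + j)) \<in> l2_space ?w"
    using p by (simp add: h_space_iff_shifts[OF a] q_def)
  note rb = remainder_shift_bound[OF a k N q K]
  have e: "(charlier_proj a (N - 1) p x - p x) * poisson_weight_inv a x = - r x" for x
    unfolding r_def q_def by (rule charlier_proj_error[OF a N])
  have "(\<lambda>x. - r (x + j)) \<in> l2_space ?w" if "j \<le> m" for j
    using l2_space_scale[OF rb(1)[OF that], of "-1"] by (simp add: r_def)
  then have mem: "(\<lambda>x. charlier_proj a (N - 1) p x - p x) \<in> h_space k (poisson_weight_inv a)"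
    using k unfolding h_space_iff_shifts[OF a] e by simp
  have root: "t powr (real j / 2) = sqrt (t ^ j)" if "t > 0" for t :: real and j
    using that by (simp add: powr_half_sqrt[symmetric] powr_powr flip: powr_realpow)
  have "h_norm a k (poisson_weight_inv a) (\<lambda>x. charlier_proj a (N - 1) p x - p x)
      = sqrt (\<Sum>j\<le>k. weighted_inner ?w (\<lambda>x. r (x + j)) (\<lambda>x. r (x + j)))"
    unfolding h_norm_eq_shifts[OF a mem] e by (simp add: weighted_inner_def)
  also have "\<dots> \<le> sqrt ((real (Suc m)) ^ 3 * 16 ^ m * K * ((a / real N) ^ m * ?M ^ k)
        * (\<Sum>j\<le>m. weighted_inner ?w (\<lambda>x. q (x + j)) (\<lambda>x. q (x + j))))"
    using rb(2) unfolding r_def by (rule real_sqrt_le_mono)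
  also have "\<dots> = sqrt ((real (Suc m)) ^ 3 * 16 ^ m * K) * sqrt ((a / real N) ^ m) * sqrt (?M ^ k)
        * h_norm a m (poisson_weight_inv a) p"
    unfolding h_norm_eq_shifts[OF a p] q_def by (simp add: real_sqrt_mult mult.assoc)
  also have "sqrt ((a / real N) ^ m) = (a / real N) powr (real m / 2)"
    using a N by (intro root[symmetric]) simp
  also have "sqrt (?M ^ k) = ?M powr (real k / 2)"
    by (intro root[symmetric]) simp
  finally show ?thesis
    using mem by blast
qed

theorem theorem3p4:
  fixes m :: nat
  shows "(\<forall>a::real. a > 0 \<longrightarrow>
           (\<exists>C::real. C > 0 \<and>
             (\<forall>k\<le>m. \<forall>p \<in> h_space m (poisson_weight_inv a). \<forall>N\<ge>1::nat.
               (\<lambda>x. charlier_proj a (N - 1) p x - p x) \<in> h_space k (poisson_weight_inv a) \<and>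
               h_norm a k (poisson_weight_inv a) (\<lambda>x. charlier_proj a (N - 1) p x - p x)
                 \<le> C * (a / real N) powr (real m / 2) * (max 1 (real N / a)) powr (real k / 2)
                     * h_norm a m (poisson_weight_inv a) p)))
       \<and> (\<exists>C::real. C > 0 \<and>
           (\<forall>a\<ge>1::real. \<forall>k\<le>m. \<forall>p \<in> h_space m (poisson_weight_inv a). \<forall>N\<ge>1::nat.
               (\<lambda>x. charlier_proj a (N - 1) p x - p x) \<in> h_space k (poisson_weight_inv a) \<and>
               h_norm a k (poisson_weight_inv a) (\<lambda>x. charlier_proj a (N - 1) p x - p x)
                 \<le> C * (a / real N) powr (real m / 2) * (max 1 (real N / a)) powr (real k / 2)
                     * h_norm a m (poisson_weight_inv a) p))"
proof -
  define C where "C = (\<lambda>K. sqrt ((real (Suc m)) ^ 3 * 16 ^ m * K))"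
  \<comment> \<open>including \<open>0 ^ 0 = 1\<close>\<close>
  have mm: "real m ^ m > 0"
    by (cases m) auto
  have C_pos: "C K > 0" if "K \<ge> real m ^ m" for K
    using order_less_le_trans[OF mm that] by (simp add: C_def)
  show ?thesis
  proof (intro conjI allI impI)
    fix a :: real
    assume a: "a > 0"
    \<comment> \<open>the least \<open>K\<close> that satisfies both conditions of the error bound\<close>
    define K where "K = real m ^ m * max 1 (1 / a ^ m)"
    have K1: "K \<ge> real m ^ m"
      using mm by (simp add: K_def)
    have "max 1 (1 / a ^ m) * a ^ m \<ge> 1"
      using mult_right_mono[of "1 / a ^ m" "max 1 (1 / a ^ m)" "a ^ m"] a by simp
    then have K2: "K * a ^ m \<ge> real m ^ m"
      using mm by (simp add: K_def mult.assoc)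
    show "\<exists>C::real. C > 0 \<and>
             (\<forall>k\<le>m. \<forall>p \<in> h_space m (poisson_weight_inv a). \<forall>N\<ge>1::nat.
               (\<lambda>x. charlier_proj a (N - 1) p x - p x) \<in> h_space k (poisson_weight_inv a) \<and>
               h_norm a k (poisson_weight_inv a) (\<lambda>x. charlier_proj a (N - 1) p x - p x)
                 \<le> C * (a / real N) powr (real m / 2) * (max 1 (real N / a)) powr (real k / 2)
                     * h_norm a m (poisson_weight_inv a) p)"
      using C_pos[OF K1] charlier_proj_error_bound[OF a _ _ _ K1 K2]
      by (intro exI[of _ "C K"]) (simp add: C_def)
  next
    have K2: "real m ^ m * a ^ m \<ge> real m ^ m" if "a \<ge> 1" for a
      using mm that by (simp add: one_le_power)
    show "\<exists>C::real. C > 0 \<and>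
           (\<forall>a\<ge>1::real. \<forall>k\<le>m. \<forall>p \<in> h_space m (poisson_weight_inv a). \<forall>N\<ge>1::nat.
               (\<lambda>x. charlier_proj a (N - 1) p x - p x) \<in> h_space k (poisson_weight_inv a) \<and>
               h_norm a k (poisson_weight_inv a) (\<lambda>x. charlier_proj a (N - 1) p x - p x)
                 \<le> C * (a / real N) powr (real m / 2) * (max 1 (real N / a)) powr (real k / 2)
                     * h_norm a m (poisson_weight_inv a) p)"
      using C_pos[OF order_refl] charlier_proj_error_bound[OF _ _ _ _ order_refl K2]
      by (intro exI[of _ "C (real m ^ m)"]) (simp add: C_def)
  qed
qed

end
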